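(* Let $(X,d_X)$ be a metric space. Then $X$ is an R-space if and only if the inverse semigroup $M(X)$ is commutative.
   Context: R-space: a metric space $(X,d_X)$ is an R-space if, for any $C>0$ and any two sequences $\{x_n\}_{n\in\mathbb N}$, $\{y_n\}_{n\in\mathbb N}$ of points of $X$ satisfying $|d_X(x_n,x_m)-d_X(y_n,y_m)|<C$ for all $n,m\in\mathbb N$, there exists $D>0$ such that $d_X(x_n,y_n)<D$ for all $n\in\mathbb N$. The inverse semigroup $M(X)$: the double of $X$ is $X\sqcup X'$, where $X=X\times\{0\}$ and $X'=X\times\{1\}$ are two copies of $X$; write $x=(x,0)$ and $x'=(x,1)$. Let $\mathcal M(X)$ be the set of all metrics $d$ on $X\sqcup X'$ whose restriction to each of the two copies of $X$ is $d_X$ and which satisfy $\inf_{x,y\in X}d(x,y')>0$. Two metrics $b,d$ on a set $Z$ are coarsely equivalent if there are monotone functions $\varphi,\psi:[0,\infty)\to[0,\infty)$ with $\lim_{t\to\infty}\varphi(t)=\lim_{t\to\infty}\psi(t)=\infty$ such that $\varphi(d(z_1,z_2))\le b(z_1,z_2)\le\psi(d(z_1,z_2))$ for all $z_1,z_2\in Z$; $[d]$ denotes the coarse equivalence class of $d$. $M(X)$ is the set of coarse equivalence classes of metrics in $\mathcal M(X)$, with multiplication $[\rho][d]=[\rho\circ d]$, where $\rho\circ d\in\mathcal M(X)$ is determined by $(\rho\circ d)(x,z')=\inf_{y\in X}[d(x,y')+\rho(y,z')]$ for $x,z\in X$. It is known that this is well defined and that $M(X)$ is an inverse semigroup. *)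

theory Defs
  imports "HOL-Analysis.Analysis"
begin

text \<open>A metric space is a carrier \<open>X\<close> with a distance \<open>dX\<close> satisfying
  \<^const>\<open>Metric_space\<close>. Distances are total functions, whose values off the carrier only have to be
  nonnegative and symmetric and play no role.\<close>

definition R_space :: "'a set \<Rightarrow> ('a \<Rightarrow> 'a \<Rightarrow> real) \<Rightarrow> bool" where
  "R_space X dX \<longleftrightarrow>
     (\<forall>C>0. \<forall>x y :: nat \<Rightarrow> 'a.
        range x \<subseteq> X \<and> range y \<subseteq> X \<and>
        (\<forall>n m. \<bar>dX (x n) (x m) - dX (y n) (y m)\<bar> < C) \<longrightarrow>
        (\<exists>D>0. \<forall>n. dX (x n) (y n) < D))"

definition coarse_equiv :: "'z set \<Rightarrow> ('z \<Rightarrow> 'z \<Rightarrow> real) \<Rightarrow> ('z \<Rightarrow> 'z \<Rightarrow> real) \<Rightarrow> bool" where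
  "coarse_equiv Z b d \<longleftrightarrow>
     (\<exists>\<phi> \<psi> :: real \<Rightarrow> real.
        \<phi> \<in> {0..} \<rightarrow> {0..} \<and> \<psi> \<in> {0..} \<rightarrow> {0..} \<and>
        mono_on {0..} \<phi> \<and> mono_on {0..} \<psi> \<and>
        filterlim \<phi> at_top at_top \<and> filterlim \<psi> at_top at_top \<and>
        (\<forall>z1\<in>Z. \<forall>z2\<in>Z. \<phi> (d z1 z2) \<le> b z1 z2 \<and> b z1 z2 \<le> \<psi> (d z1 z2)))"

text \<open>The double of \<open>X\<close> is the disjoint sum \<open>X <+> X\<close>, with \<open>x = Inl x\<close> and \<open>x' = Inr x\<close>.
  The infimum is taken in the extended reals so that it is \<open>\<infinity>\<close> when \<open>X\<close> is empty.\<close>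

definition double_metrics ::
    "'a set \<Rightarrow> ('a \<Rightarrow> 'a \<Rightarrow> real) \<Rightarrow> ('a + 'a \<Rightarrow> 'a + 'a \<Rightarrow> real) set" where
  "double_metrics X dX =
     {d. Metric_space (X <+> X) d \<and>
         (\<forall>x\<in>X. \<forall>y\<in>X. d (Inl x) (Inl y) = dX x y \<and> d (Inr x) (Inr y) = dX x y) \<and>
         (INF x\<in>X. INF y\<in>X. ereal (d (Inl x) (Inr y))) > 0}"

text \<open>\<open>double_comp X dX \<rho> d\<close> is \<open>\<rho> \<circ> d\<close>: first \<open>d\<close>, then \<open>\<rho>\<close>. The remaining values
  are forced by symmetry and by the restriction to the two copies of \<open>X\<close>.\<close>

fun double_comp ::
    "'a set \<Rightarrow> ('a \<Rightarrow> 'a \<Rightarrow> real) \<Rightarrow> ('a + 'a \<Rightarrow> 'a + 'a \<Rightarrow> real) \<Rightarrow> ('a + 'a \<Rightarrow> 'a + 'a \<Rightarrow> real)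
      \<Rightarrow> 'a + 'a \<Rightarrow> 'a + 'a \<Rightarrow> real" where
  "double_comp X dX \<rho> d (Inl x) (Inl y) = dX x y"
| "double_comp X dX \<rho> d (Inr x) (Inr y) = dX x y"
| "double_comp X dX \<rho> d (Inl x) (Inr z) = (INF y\<in>X. d (Inl x) (Inr y) + \<rho> (Inl y) (Inr z))"
| "double_comp X dX \<rho> d (Inr z) (Inl x) = (INF y\<in>X. d (Inl x) (Inr y) + \<rho> (Inl y) (Inr z))"

definition coarse_rel ::
    "'a set \<Rightarrow> ('a \<Rightarrow> 'a \<Rightarrow> real) \<Rightarrow> (('a + 'a \<Rightarrow> 'a + 'a \<Rightarrow> real) \<times> ('a + 'a \<Rightarrow> 'a + 'a \<Rightarrow> real)) set" where
  "coarse_rel X dX =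
     {(b, d). b \<in> double_metrics X dX \<and> d \<in> double_metrics X dX \<and> coarse_equiv (X <+> X) b d}"

definition M_carrier ::
    "'a set \<Rightarrow> ('a \<Rightarrow> 'a \<Rightarrow> real) \<Rightarrow> ('a + 'a \<Rightarrow> 'a + 'a \<Rightarrow> real) set set" where
  "M_carrier X dX = double_metrics X dX // coarse_rel X dX"

text \<open>The union over representatives is the usual lifting of an operation to a quotient; that it
  gives \<open>[\<rho>][d] = [\<rho> \<circ> d]\<close> is the lemma \<open>M_mult_class\<close> below.
  (If \<open>X\<close> is empty, there is only one class.)\<close>

definition M_mult ::
    "'a set \<Rightarrow> ('a \<Rightarrow> 'a \<Rightarrow> real) \<Rightarrow> ('a + 'a \<Rightarrow> 'a + 'a \<Rightarrow> real) set
      \<Rightarrow> ('a + 'a \<Rightarrow> 'a + 'a \<Rightarrow> real) set \<Rightarrow> ('a + 'a \<Rightarrow> 'a + 'a \<Rightarrow> real) set" where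
  "M_mult X dX a b = (\<Union>\<rho>\<in>a. \<Union>d\<in>b. coarse_rel X dX `` {double_comp X dX \<rho> d})"


subsection \<open>Well-definedness of the multiplication\<close>

lemma coarse_equiv_iff:
  assumes b0: "\<And>z1 z2. z1 \<in> Z \<Longrightarrow> z2 \<in> Z \<Longrightarrow> 0 \<le> b z1 z2"
    and d0: "\<And>z1 z2. z1 \<in> Z \<Longrightarrow> z2 \<in> Z \<Longrightarrow> 0 \<le> d z1 z2"
  shows "coarse_equiv Z b d \<longleftrightarrow>
     (\<forall>R. \<exists>S. \<forall>z1\<in>Z. \<forall>z2\<in>Z. d z1 z2 \<le> R \<longrightarrow> b z1 z2 \<le> S) \<and>
     (\<forall>R. \<exists>S. \<forall>z1\<in>Z. \<forall>z2\<in>Z. b z1 z2 \<le> R \<longrightarrow> d z1 z2 \<le> S)"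
    (is "_ \<longleftrightarrow> ?A \<and> ?B")
proof
  assume "coarse_equiv Z b d"
  then obtain \<phi> \<psi> :: "real \<Rightarrow> real" where
      mono: "mono_on {0..} \<phi>" "mono_on {0..} \<psi>"
    and lim: "filterlim \<phi> at_top at_top"
    and le: "\<And>z1 z2. z1 \<in> Z \<Longrightarrow> z2 \<in> Z \<Longrightarrow> \<phi> (d z1 z2) \<le> b z1 z2 \<and> b z1 z2 \<le> \<psi> (d z1 z2)"
    unfolding coarse_equiv_def by blast
  have ?A
  proof
    fix R
    have "b z1 z2 \<le> \<psi> R" if "z1 \<in> Z" "z2 \<in> Z" "d z1 z2 \<le> R" for z1 z2
      using le[OF that(1,2)] mono_onD[OF mono(2), of "d z1 z2" R] d0[OF that(1,2)] that(3)
      by fastforce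
    then show "\<exists>S. \<forall>z1\<in>Z. \<forall>z2\<in>Z. d z1 z2 \<le> R \<longrightarrow> b z1 z2 \<le> S" by blast
  qed
  moreover have ?B
  proof
    fix R
    obtain S where S: "\<And>t. t \<ge> S \<Longrightarrow> \<phi> t \<ge> R + 1"
      using lim unfolding filterlim_at_top eventually_at_top_linorder by blast
    have "d z1 z2 \<le> S" if "z1 \<in> Z" "z2 \<in> Z" "b z1 z2 \<le> R" for z1 z2
      using le[OF that(1,2)] S[of "d z1 z2"] that(3) by fastforce
    then show "\<exists>S. \<forall>z1\<in>Z. \<forall>z2\<in>Z. b z1 z2 \<le> R \<longrightarrow> d z1 z2 \<le> S" by blast
  qed
  ultimately show "?A \<and> ?B" ..
next
  assume AB: "?A \<and> ?B"
  define P where "P t = insert 0 {b z1 z2 |z1 z2. z1 \<in> Z \<and> z2 \<in> Z \<and> d z1 z2 \<le> t}" for t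
  define Q where "Q t = insert t {b z1 z2 |z1 z2. z1 \<in> Z \<and> z2 \<in> Z \<and> t \<le> d z1 z2}" for t
  define \<psi> where "\<psi> t = t + Sup (P t)" for t
  define \<phi> where "\<phi> t = Inf (Q t)" for t
  have bP: "bdd_above (P t)" for t
  proof -
    obtain S where "\<forall>z1\<in>Z. \<forall>z2\<in>Z. d z1 z2 \<le> t \<longrightarrow> b z1 z2 \<le> S" using AB by blast
    then show ?thesis unfolding P_def bdd_above_def by (intro exI[of _ "max 0 S"]) fastforce
  qed
  have bQ: "bdd_below (Q t)" for t
    unfolding Q_def bdd_below_def using b0 by (intro exI[of _ "min 0 t"]) fastforce
  have P0: "0 \<le> Sup (P t)" for t
    by (rule cSup_upper[OF _ bP]) (simp add: P_def)
  have psi: "\<psi> \<in> {0..} \<rightarrow> {0..}" using P0 by (auto simp: \<psi>_def add_nonneg_nonneg)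
  have phi: "\<phi> \<in> {0..} \<rightarrow> {0..}"
  proof
    fix t :: real assume t: "t \<in> {0..}"
    have "0 \<le> Inf (Q t)" by (rule cInf_greatest) (use t b0 in \<open>auto simp: Q_def\<close>)
    then show "\<phi> t \<in> {0..}" by (simp add: \<phi>_def)
  qed
  have mpsi: "mono_on {0..} \<psi>"
  proof (rule mono_onI)
    fix r s :: real assume rs: "r \<le> s"
    have "P r \<subseteq> P s" using rs unfolding P_def by fastforce
    then have "Sup (P r) \<le> Sup (P s)" by (intro cSup_subset_mono bP) (auto simp: P_def)
    then show "\<psi> r \<le> \<psi> s" using rs by (simp add: \<psi>_def)
  qed
  have mphi: "mono_on {0..} \<phi>"
  proof (rule mono_onI)
    fix r s :: real assume rs: "r \<le> s"
    have "Inf (Q r) \<le> Inf (Q s)"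
    proof (rule cInf_mono[OF _ bQ])
      fix q assume "q \<in> Q s"
      then consider "q = s" | z1 z2 where "q = b z1 z2" "z1 \<in> Z" "z2 \<in> Z" "s \<le> d z1 z2"
        unfolding Q_def by blast
      then show "\<exists>a\<in>Q r. a \<le> q"
      proof cases
        case 1 then show ?thesis using rs by (intro bexI[of _ r]) (auto simp: Q_def)
      next
        case 2 then show ?thesis using rs by (intro bexI[of _ q]) (force simp: Q_def)+
      qed
    qed (simp add: Q_def)
    then show "\<phi> r \<le> \<phi> s" by (simp add: \<phi>_def)
  qed
  have lpsi: "filterlim \<psi> at_top at_top"
    by (rule filterlim_at_top_mono[OF filterlim_ident]) (simp add: \<psi>_def P0)
  have lphi: "filterlim \<phi> at_top at_top"
    unfolding filterlim_at_top eventually_at_top_linorder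
  proof
    fix T
    obtain S where S: "\<forall>z1\<in>Z. \<forall>z2\<in>Z. b z1 z2 \<le> T \<longrightarrow> d z1 z2 \<le> S" using AB by blast
    have "T \<le> \<phi> t" if t: "t \<ge> max S T + 1" for t
      unfolding \<phi>_def
    proof (rule cInf_greatest)
      fix q assume "q \<in> Q t"
      then show "T \<le> q" using S t unfolding Q_def by fastforce
    qed (simp add: Q_def)
    then show "\<exists>N. \<forall>n\<ge>N. T \<le> \<phi> n" by blast
  qed
  have "\<phi> (d z1 z2) \<le> b z1 z2 \<and> b z1 z2 \<le> \<psi> (d z1 z2)" if "z1 \<in> Z" "z2 \<in> Z" for z1 z2
  proof
    show "\<phi> (d z1 z2) \<le> b z1 z2"
      unfolding \<phi>_def by (rule cInf_lower[OF _ bQ]) (use that in \<open>auto simp: Q_def\<close>)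
    have "b z1 z2 \<le> Sup (P (d z1 z2))"
      by (rule cSup_upper[OF _ bP]) (use that in \<open>auto simp: P_def\<close>)
    then show "b z1 z2 \<le> \<psi> (d z1 z2)" using d0[OF that] by (simp add: \<psi>_def)
  qed
  then show "coarse_equiv Z b d"
    unfolding coarse_equiv_def using psi phi mpsi mphi lpsi lphi by blast
qed

lemma double_metrics_nonneg:
  "d \<in> double_metrics X dX \<Longrightarrow> 0 \<le> d z1 z2"
  using Metric_space.nonneg[of "X <+> X" d] by (simp add: double_metrics_def)

lemma coarse_equiv_iff':
  assumes "b \<in> double_metrics X dX" "d \<in> double_metrics X dX"
  shows "coarse_equiv (X <+> X) b d \<longleftrightarrow>
     (\<forall>R. \<exists>S. \<forall>z1\<in>X <+> X. \<forall>z2\<in>X <+> X. d z1 z2 \<le> R \<longrightarrow> b z1 z2 \<le> S) \<and>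
     (\<forall>R. \<exists>S. \<forall>z1\<in>X <+> X. \<forall>z2\<in>X <+> X. b z1 z2 \<le> R \<longrightarrow> d z1 z2 \<le> S)"
  by (rule coarse_equiv_iff) (use assms in \<open>auto intro: double_metrics_nonneg\<close>)

lemma equiv_coarse_rel: "equiv (double_metrics X dX) (coarse_rel X dX)"
proof (rule equivI)
  show "coarse_rel X dX \<subseteq> double_metrics X dX \<times> double_metrics X dX"
    by (auto simp: coarse_rel_def)
  show "refl_on (double_metrics X dX) (coarse_rel X dX)"
    by (intro refl_onI) (auto simp: coarse_rel_def coarse_equiv_iff')
  show "sym (coarse_rel X dX)"
    by (intro symI) (auto simp: coarse_rel_def coarse_equiv_iff')
  show "trans (coarse_rel X dX)"
  proof (rule transI)
    fix a b c assume "(a, b) \<in> coarse_rel X dX" "(b, c) \<in> coarse_rel X dX"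
    then have m: "a \<in> double_metrics X dX" "b \<in> double_metrics X dX" "c \<in> double_metrics X dX"
      and *: "coarse_equiv (X <+> X) a b" "coarse_equiv (X <+> X) b c"
      by (auto simp: coarse_rel_def)
    have "coarse_equiv (X <+> X) a c"
      using * unfolding coarse_equiv_iff'[OF m(1,2)] coarse_equiv_iff'[OF m(2,3)]
        coarse_equiv_iff'[OF m(1,3)] by meson
    then show "(a, c) \<in> coarse_rel X dX" using m by (simp add: coarse_rel_def)
  qed
qed

lemma double_metrics_sep:
  assumes "d \<in> double_metrics X dX"
  obtains e where "e > 0" "\<And>x y. x \<in> X \<Longrightarrow> y \<in> X \<Longrightarrow> e \<le> d (Inl x) (Inr y)"
proof -
  have "(INF x\<in>X. INF y\<in>X. ereal (d (Inl x) (Inr y))) > 0"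
    using assms by (simp add: double_metrics_def)
  then obtain e where e: "ereal e > 0" "ereal e < (INF x\<in>X. INF y\<in>X. ereal (d (Inl x) (Inr y)))"
    using ereal_dense2 by blast
  have "e \<le> d (Inl x) (Inr y)" if "x \<in> X" "y \<in> X" for x y
  proof -
    have "(INF x\<in>X. INF y\<in>X. ereal (d (Inl x) (Inr y))) \<le> ereal (d (Inl x) (Inr y))"
      using that by (meson INF_lower2 order_refl)
    then have "ereal e \<le> ereal (d (Inl x) (Inr y))" using e(2) by order
    then show ?thesis by simp
  qed
  then show ?thesis using e(1) that by auto
qed

context
  fixes X :: "'a set" and dX \<rho> d
  assumes ne: "X \<noteq> {}" and X: "Metric_space X dX"
    and \<rho>: "\<rho> \<in> double_metrics X dX" and d: "d \<in> double_metrics X dX"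
begin

lemma bdd_comp: "bdd_below ((\<lambda>y. d (Inl x) (Inr y) + \<rho> (Inl y) (Inr z)) ` X)"
  unfolding bdd_below_def
  by (intro exI[of _ 0]) (auto intro!: add_nonneg_nonneg double_metrics_nonneg[OF \<rho>] double_metrics_nonneg[OF d])

lemma comp_le:
  "y \<in> X \<Longrightarrow> double_comp X dX \<rho> d (Inl x) (Inr z) \<le> d (Inl x) (Inr y) + \<rho> (Inl y) (Inr z)"
  by (simp add: cINF_lower[OF bdd_comp])

lemma comp_ge:
  "(\<And>y. y \<in> X \<Longrightarrow> c \<le> d (Inl x) (Inr y) + \<rho> (Inl y) (Inr z)) \<Longrightarrow>
    c \<le> double_comp X dX \<rho> d (Inl x) (Inr z)"
  by (simp add: cINF_greatest[OF ne])

lemma comp_commute: "double_comp X dX \<rho> d z1 z2 = double_comp X dX \<rho> d z2 z1"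
  by (cases z1; cases z2) (auto simp: Metric_space.commute[OF X])

lemma comp_in_double_metrics: "double_comp X dX \<rho> d \<in> double_metrics X dX"
proof -
  let ?c = "double_comp X dX \<rho> d"
  obtain e1 where e1: "e1 > 0" "\<And>x y. x \<in> X \<Longrightarrow> y \<in> X \<Longrightarrow> e1 \<le> d (Inl x) (Inr y)"
    using double_metrics_sep[OF d] by blast
  note nonneg = double_metrics_nonneg[OF \<rho>] double_metrics_nonneg[OF d] Metric_space.nonneg[OF X]
  have M\<rho>: "Metric_space (X <+> X) \<rho>" and Md: "Metric_space (X <+> X) d"
    using \<rho> d by (auto simp: double_metrics_def)
  have r: "d (Inl x) (Inl y) = dX x y" "d (Inr x) (Inr y) = dX x y"
      "\<rho> (Inl x) (Inl y) = dX x y" "\<rho> (Inr x) (Inr y) = dX x y" if "x \<in> X" "y \<in> X" for x y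
    using \<rho> d that by (auto simp: double_metrics_def)
  have tri_d: "d a c \<le> d a b + d b c" if "a \<in> X <+> X" "b \<in> X <+> X" "c \<in> X <+> X" for a b c
    using Metric_space.triangle[OF Md] that by blast
  have tri_\<rho>: "\<rho> a c \<le> \<rho> a b + \<rho> b c" if "a \<in> X <+> X" "b \<in> X <+> X" "c \<in> X <+> X" for a b c
    using Metric_space.triangle[OF M\<rho>] that by blast
  have com: "d a b = d b a" "\<rho> a b = \<rho> b a" for a b
    using Metric_space.commute[OF Md] Metric_space.commute[OF M\<rho>] by blast+
  have pos: "e1 \<le> ?c (Inl x) (Inr z)" if "x \<in> X" "z \<in> X" for x z
    by (rule comp_ge) (use e1 that nonneg(1) in \<open>meson add_increasing2\<close>)
  have t1: "?c (Inl x) (Inr z) \<le> dX x y + ?c (Inl y) (Inr z)" if "x \<in> X" "y \<in> X" "z \<in> X" for x y z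
  proof -
    have "?c (Inl x) (Inr z) - dX x y \<le> ?c (Inl y) (Inr z)"
    proof (rule comp_ge)
      fix w assume w: "w \<in> X"
      show "?c (Inl x) (Inr z) - dX x y \<le> d (Inl y) (Inr w) + \<rho> (Inl w) (Inr z)"
        using comp_le[OF w, of x z] tri_d[of "Inl x" "Inl y" "Inr w"] w that r(1)[of x y]
        by (simp add: InlI InrI del: double_comp.simps)
    qed
    then show ?thesis by simp
  qed
  have t2: "?c (Inl x) (Inr z) \<le> ?c (Inl x) (Inr y) + dX y z" if "x \<in> X" "y \<in> X" "z \<in> X" for x y z
  proof -
    have "?c (Inl x) (Inr z) - dX y z \<le> ?c (Inl x) (Inr y)"
    proof (rule comp_ge)
      fix w assume w: "w \<in> X"
      show "?c (Inl x) (Inr z) - dX y z \<le> d (Inl x) (Inr w) + \<rho> (Inl w) (Inr y)"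
        using comp_le[OF w, of x z] tri_\<rho>[of "Inl w" "Inr y" "Inr z"] w that r(4)[of y z]
        by (simp add: InlI InrI del: double_comp.simps)
    qed
    then show ?thesis by simp
  qed
  have t3: "dX x z \<le> ?c (Inl x) (Inr y) + ?c (Inl z) (Inr y)" if "x \<in> X" "y \<in> X" "z \<in> X" for x y z
  proof -
    have "dX x z - ?c (Inl z) (Inr y) \<le> ?c (Inl x) (Inr y)"
    proof (rule comp_ge)
      fix u assume u: "u \<in> X"
      have "dX x z - (d (Inl x) (Inr u) + \<rho> (Inl u) (Inr y)) \<le> ?c (Inl z) (Inr y)"
      proof (rule comp_ge)
        fix v assume v: "v \<in> X"
        have "dX x z \<le> d (Inl x) (Inr u) + d (Inr u) (Inl z)"
          using tri_d[of "Inl x" "Inr u" "Inl z"] r(1)[of x z] u that by auto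
        moreover have "d (Inr u) (Inl z) \<le> dX u v + d (Inr v) (Inl z)"
          using tri_d[of "Inr u" "Inr v" "Inl z"] r(2)[of u v] u v that by auto
        moreover have "dX u v \<le> \<rho> (Inl u) (Inr y) + \<rho> (Inr y) (Inl v)"
          using tri_\<rho>[of "Inl u" "Inr y" "Inl v"] r(3)[of u v] u v that by auto
        ultimately show "dX x z - (d (Inl x) (Inr u) + \<rho> (Inl u) (Inr y))
            \<le> d (Inl z) (Inr v) + \<rho> (Inl v) (Inr y)"
          using com(1)[of "Inr v" "Inl z"] com(2)[of "Inr y" "Inl v"] by linarith
      qed
      then show "dX x z - ?c (Inl z) (Inr y) \<le> d (Inl x) (Inr u) + \<rho> (Inl u) (Inr y)" by simp
    qed
    then show ?thesis by simp
  qed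
  have t4: "dX x z \<le> ?c (Inl y) (Inr x) + ?c (Inl y) (Inr z)" if "x \<in> X" "y \<in> X" "z \<in> X" for x y z
  proof -
    have "dX x z - ?c (Inl y) (Inr z) \<le> ?c (Inl y) (Inr x)"
    proof (rule comp_ge)
      fix u assume u: "u \<in> X"
      have "dX x z - (d (Inl y) (Inr u) + \<rho> (Inl u) (Inr x)) \<le> ?c (Inl y) (Inr z)"
      proof (rule comp_ge)
        fix v assume v: "v \<in> X"
        have "dX x z \<le> \<rho> (Inr x) (Inl u) + \<rho> (Inl u) (Inr z)"
          using tri_\<rho>[of "Inr x" "Inl u" "Inr z"] r(4)[of x z] u that by auto
        moreover have "\<rho> (Inl u) (Inr z) \<le> dX u v + \<rho> (Inl v) (Inr z)"
          using tri_\<rho>[of "Inl u" "Inl v" "Inr z"] r(3)[of u v] u v that by auto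
        moreover have "dX u v \<le> d (Inr u) (Inl y) + d (Inl y) (Inr v)"
          using tri_d[of "Inr u" "Inl y" "Inr v"] r(2)[of u v] u v that by auto
        ultimately show "dX x z - (d (Inl y) (Inr u) + \<rho> (Inl u) (Inr x))
            \<le> d (Inl y) (Inr v) + \<rho> (Inl v) (Inr z)"
          using com(1)[of "Inr u" "Inl y"] com(2)[of "Inr x" "Inl u"] by linarith
      qed
      then show "dX x z - ?c (Inl y) (Inr z) \<le> d (Inl y) (Inr u) + \<rho> (Inl u) (Inr x)" by simp
    qed
    then show ?thesis by simp
  qed
  have lr: "?c (Inr x) (Inl y) = ?c (Inl y) (Inr x)" for x y by (rule comp_commute)
  have M: "Metric_space (X <+> X) ?c"
  proof
    fix a b
    have "0 \<le> ?c (Inl x) (Inr y)" for x y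
      by (rule comp_ge) (simp add: nonneg)
    then show "0 \<le> ?c a b"
      using lr nonneg(3) by (cases a; cases b) (auto simp del: double_comp.simps(3,4))
    show "?c a b = ?c b a" by (rule comp_commute)
  next
    fix a b assume ab: "a \<in> X <+> X" "b \<in> X <+> X"
    have "?c (Inl x) (Inr y) \<noteq> 0" if "x \<in> X" "y \<in> X" for x y
      using pos[OF that] e1(1) by linarith
    then show "?c a b = 0 \<longleftrightarrow> a = b"
      using ab lr Metric_space.zero[OF X] by (cases a; cases b) (auto simp del: double_comp.simps(3,4))
  next
    fix a b c assume abc: "a \<in> X <+> X" "b \<in> X <+> X" "c \<in> X <+> X"
    have tX: "dX x z \<le> dX x y + dX y z" if "x \<in> X" "y \<in> X" "z \<in> X" for x y z
      using Metric_space.triangle[OF X] that by blast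
    have comX: "dX x y = dX y x" for x y by (rule Metric_space.commute[OF X])
    obtain x y z where xyz: "a = Inl x \<or> a = Inr x" "b = Inl y \<or> b = Inr y" "c = Inl z \<or> c = Inr z"
        "x \<in> X" "y \<in> X" "z \<in> X"
      using abc by blast
    have ss: "?c (Inl u) (Inl v) = dX u v" "?c (Inr u) (Inr v) = dX u v" for u v by simp_all
    note f = t1[OF xyz(4,5,6)] t1[OF xyz(6,5,4)] t2[OF xyz(4,5,6)] t2[OF xyz(6,5,4)]
      t3[OF xyz(4,5,6)] t4[OF xyz(4,5,6)] tX[OF xyz(4,5,6)] comX[of z y] comX[of y x]
    show "?c a c \<le> ?c a b + ?c b c"
      using xyz(1,2,3) by (elim disjE; simp only: ss lr; use f in linarith)
  qed
  have "ereal e1 \<le> (INF x\<in>X. INF y\<in>X. ereal (?c (Inl x) (Inr y)))"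
    using pos by (intro INF_greatest) (simp del: double_comp.simps(3,4))
  moreover have "0 < ereal e1" using e1(1) by simp
  ultimately have "0 < (INF x\<in>X. INF y\<in>X. ereal (?c (Inl x) (Inr y)))" by order
  then show ?thesis using M unfolding double_metrics_def by simp
qed

end

lemma coarse_comp_half:
  assumes ne: "X \<noteq> {}" and X: "Metric_space X dX"
    and m: "\<rho> \<in> double_metrics X dX" "d \<in> double_metrics X dX"
      "\<rho>' \<in> double_metrics X dX" "d' \<in> double_metrics X dX"
    and h1: "\<forall>R. \<exists>S. \<forall>z1\<in>X <+> X. \<forall>z2\<in>X <+> X. \<rho> z1 z2 \<le> R \<longrightarrow> \<rho>' z1 z2 \<le> S"
    and h2: "\<forall>R. \<exists>S. \<forall>z1\<in>X <+> X. \<forall>z2\<in>X <+> X. d z1 z2 \<le> R \<longrightarrow> d' z1 z2 \<le> S"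
  shows "\<forall>R. \<exists>S. \<forall>z1\<in>X <+> X. \<forall>z2\<in>X <+> X.
    double_comp X dX \<rho> d z1 z2 \<le> R \<longrightarrow> double_comp X dX \<rho>' d' z1 z2 \<le> S"
proof
  fix R
  let ?c = "double_comp X dX \<rho> d" and ?c' = "double_comp X dX \<rho>' d'"
  obtain S1 where S1: "\<forall>z1\<in>X <+> X. \<forall>z2\<in>X <+> X. \<rho> z1 z2 \<le> R + 1 \<longrightarrow> \<rho>' z1 z2 \<le> S1"
    using h1 by blast
  obtain S2 where S2: "\<forall>z1\<in>X <+> X. \<forall>z2\<in>X <+> X. d z1 z2 \<le> R + 1 \<longrightarrow> d' z1 z2 \<le> S2"
    using h2 by blast
  have lr: "?c' (Inl x) (Inr z) \<le> S1 + S2" if xz: "x \<in> X" "z \<in> X" and R: "?c (Inl x) (Inr z) \<le> R" for x z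
  proof -
    have "\<exists>y\<in>X. d (Inl x) (Inr y) + \<rho> (Inl y) (Inr z) < R + 1"
    proof (rule ccontr)
      assume "\<not> ?thesis"
      then have "R + 1 \<le> ?c (Inl x) (Inr z)"
        by (intro comp_ge[OF ne X m(1,2)]) (simp add: not_less)
      then show False using R by linarith
    qed
    then obtain y where y: "y \<in> X" "d (Inl x) (Inr y) + \<rho> (Inl y) (Inr z) < R + 1" by blast
    have "0 \<le> d (Inl x) (Inr y)" "0 \<le> \<rho> (Inl y) (Inr z)"
      using m double_metrics_nonneg by blast+
    then have "d (Inl x) (Inr y) \<le> R + 1" "\<rho> (Inl y) (Inr z) \<le> R + 1" using y(2) by linarith+
    then have "d' (Inl x) (Inr y) \<le> S2" "\<rho>' (Inl y) (Inr z) \<le> S1"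
      using S1 S2 y(1) xz by (simp_all add: InlI InrI)
    then show ?thesis using comp_le[OF ne X m(3,4) y(1), of x z] by linarith
  qed
  have "?c' z1 z2 \<le> max R (S1 + S2)" if z: "z1 \<in> X <+> X" "z2 \<in> X <+> X" "?c z1 z2 \<le> R" for z1 z2
  proof (cases z1; cases z2)
    fix x y assume e: "z1 = Inl x" "z2 = Inr y"
    then show ?thesis using lr[of x y] z by (auto simp del: double_comp.simps(3,4))
  next
    fix x y assume e: "z1 = Inr y" "z2 = Inl x"
    have "?c (Inr y) (Inl x) = ?c (Inl x) (Inr y)" "?c' (Inr y) (Inl x) = ?c' (Inl x) (Inr y)" by simp_all
    then show ?thesis using e lr[of x y] z by (auto simp del: double_comp.simps(3,4))
  qed (use z in auto)
  then show "\<exists>S. \<forall>z1\<in>X <+> X. \<forall>z2\<in>X <+> X. ?c z1 z2 \<le> R \<longrightarrow> ?c' z1 z2 \<le> S" by blast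
qed

lemma M_mult_class:
  assumes ne: "X \<noteq> {}" and X: "Metric_space X dX"
    and m: "\<rho> \<in> double_metrics X dX" "d \<in> double_metrics X dX"
  shows "M_mult X dX (coarse_rel X dX `` {\<rho>}) (coarse_rel X dX `` {d}) =
    coarse_rel X dX `` {double_comp X dX \<rho> d}"
proof -
  have "congruent2 (coarse_rel X dX) (coarse_rel X dX)
      (\<lambda>\<rho> d. coarse_rel X dX `` {double_comp X dX \<rho> d})"
  proof (rule congruent2I')
    fix \<rho> \<rho>' d d' assume "(\<rho>, \<rho>') \<in> coarse_rel X dX" "(d, d') \<in> coarse_rel X dX"
    then have n: "\<rho> \<in> double_metrics X dX" "d \<in> double_metrics X dX"
        "\<rho>' \<in> double_metrics X dX" "d' \<in> double_metrics X dX"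
      and c: "coarse_equiv (X <+> X) \<rho> \<rho>'" "coarse_equiv (X <+> X) d d'"
      by (auto simp: coarse_rel_def)
    note c' = c[unfolded coarse_equiv_iff'[OF n(1,3)] coarse_equiv_iff'[OF n(2,4)]]
    have "coarse_equiv (X <+> X) (double_comp X dX \<rho> d) (double_comp X dX \<rho>' d')"
      unfolding coarse_equiv_iff'[OF comp_in_double_metrics[OF ne X n(1,2)] comp_in_double_metrics[OF ne X n(3,4)]]
      using c' coarse_comp_half[OF ne X n] coarse_comp_half[OF ne X n(3,4,1,2)] by blast
    then have "(double_comp X dX \<rho> d, double_comp X dX \<rho>' d') \<in> coarse_rel X dX"
      using comp_in_double_metrics[OF ne X n(1,2)] comp_in_double_metrics[OF ne X n(3,4)]
      by (simp add: coarse_rel_def)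
    then show "coarse_rel X dX `` {double_comp X dX \<rho> d} = coarse_rel X dX `` {double_comp X dX \<rho>' d'}"
      by (rule equiv_class_eq[OF equiv_coarse_rel])
  qed
  then show ?thesis
    unfolding M_mult_def by (rule UN_equiv_class2[OF equiv_coarse_rel equiv_coarse_rel _ m])
qed

end

theory Submission
  imports Defs
begin

text \<open>An element of \<open>M(X)\<close> is a coarse partial isometry, relating \<open>x\<close> to \<open>y\<close> when \<open>d x y'\<close> is
  small. In an R-space related points are close to each other, so every element is coarsely a
  partial identity, and partial identities commute. If \<open>X\<close> is not an R-space, a pair of sequences
  \<open>x\<close>, \<open>y\<close> witnessing this can be thinned out so that \<open>dX (x m) (y n) \<ge> n\<close> for all \<open>m\<close>, \<open>n\<close>; then
  the partial isometry \<open>x n \<mapsto> y n\<close> does not commute with the partial identity on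
  \<open>{x n | n}\<close>.\<close>

section \<open>Metrics on the double in which two sequences are joined by bridges\<close>

text \<open>The distance between the copies is the infimal length of a walk that crosses once, over
  a bridge of length \<open>C\<close> from \<open>u n\<close> to the copy of
  \<open>v n\<close>.\<close>

fun link_metric ::
    "('a \<Rightarrow> 'a \<Rightarrow> real) \<Rightarrow> real \<Rightarrow> (nat \<Rightarrow> 'a) \<Rightarrow> (nat \<Rightarrow> 'a) \<Rightarrow> 'a + 'a \<Rightarrow> 'a + 'a \<Rightarrow> real" where
  "link_metric dX C u v (Inl x) (Inl y) = dX x y"
| "link_metric dX C u v (Inr x) (Inr y) = dX x y"
| "link_metric dX C u v (Inl x) (Inr y) = (INF n. dX x (u n) + C + dX (v n) y)"
| "link_metric dX C u v (Inr y) (Inl x) = (INF n. dX x (u n) + C + dX (v n) y)"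

context
  fixes X :: "'a set" and dX and C :: real and u v :: "nat \<Rightarrow> 'a"
  assumes X: "Metric_space X dX" and C: "C > 0"
    and u: "range u \<subseteq> X" and v: "range v \<subseteq> X"
    and quasi: "\<And>n m. \<bar>dX (u n) (u m) - dX (v n) (v m)\<bar> \<le> 2 * C"
begin

lemma link_metric_le:
  "link_metric dX C u v (Inl x) (Inr y) \<le> dX x (u n) + C + dX (v n) y"
proof -
  have "bdd_below (range (\<lambda>n. dX x (u n) + C + dX (v n) y))"
    unfolding bdd_below_def using C Metric_space.nonneg[OF X]
    by (intro exI[of _ 0]) (auto intro!: add_nonneg_nonneg)
  from cINF_lower[OF this UNIV_I[of n]] show ?thesis by simp
qed

lemma link_metric_ge:
  "(\<And>n. c \<le> dX x (u n) + C + dX (v n) y) \<Longrightarrow> c \<le> link_metric dX C u v (Inl x) (Inr y)"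
  by (simp add: cINF_greatest)

text \<open>Crossing over bridge \<open>n\<close> and returning over bridge \<open>m\<close> costs
  \<open>2 * C\<close> for the bridges alone, and by \<open>quasi\<close> this rules out a shortcut
  within a copy. Inequalities with a single crossing hold bridge by bridge, and the length
  \<open>C\<close> of a bridge keeps the copies apart.\<close>

lemma link_metric_in_double_metrics: "link_metric dX C u v \<in> double_metrics X dX"
proof -
  let ?c = "link_metric dX C u v"
  have uX: "u n \<in> X" and vX: "v n \<in> X" for n using u v by auto
  note nonneg = Metric_space.nonneg[OF X]
  have com: "dX x y = dX y x" for x y by (rule Metric_space.commute[OF X])
  have tri: "dX x z \<le> dX x y + dX y z" if "x \<in> X" "y \<in> X" "z \<in> X" for x y z
    using Metric_space.triangle[OF X] that by blast
  have pos: "C \<le> ?c (Inl x) (Inr y)" for x y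
    by (rule link_metric_ge) (use nonneg in \<open>simp add: add_increasing add_increasing2\<close>)
  have t1: "?c (Inl x) (Inr z) \<le> dX x y + ?c (Inl y) (Inr z)" if "x \<in> X" "y \<in> X" "z \<in> X" for x y z
  proof -
    have "?c (Inl x) (Inr z) - dX x y \<le> dX y (u n) + C + dX (v n) z" for n
      using link_metric_le[of x z n] tri[OF that(1,2) uX[of n]] by linarith
    then have "?c (Inl x) (Inr z) - dX x y \<le> ?c (Inl y) (Inr z)" by (rule link_metric_ge)
    then show ?thesis by linarith
  qed
  have t2: "?c (Inl x) (Inr z) \<le> ?c (Inl x) (Inr y) + dX y z" if "x \<in> X" "y \<in> X" "z \<in> X" for x y z
  proof -
    have "?c (Inl x) (Inr z) - dX y z \<le> dX x (u n) + C + dX (v n) y" for n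
      using link_metric_le[of x z n] tri[OF vX[of n] that(2,3)] by linarith
    then have "?c (Inl x) (Inr z) - dX y z \<le> ?c (Inl x) (Inr y)" by (rule link_metric_ge)
    then show ?thesis by linarith
  qed
  have t3: "dX x z \<le> ?c (Inl x) (Inr y) + ?c (Inl z) (Inr y)" if "x \<in> X" "y \<in> X" "z \<in> X" for x y z
  proof -
    \<comment> \<open>Two crossings mean two infima: the inequality is shown for every pair of
      bridges, then the infimum is taken over \<open>m\<close> with \<open>n\<close> fixed, and
      after rearrangement over \<open>n\<close>.\<close>
    have "dX x z - (dX x (u n) + C + dX (v n) y) \<le> dX z (u m) + C + dX (v m) y" for n m
      using tri[OF that(1) uX that(3), of n] tri[OF uX uX that(3), of n m]
        tri[OF vX that(2) vX, of n m] quasi[of n m] com[of "u m" z] com[of "v m" y]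
      by linarith
    then have "dX x z - (dX x (u n) + C + dX (v n) y) \<le> ?c (Inl z) (Inr y)" for n
      by (rule link_metric_ge)
    then have "dX x z - ?c (Inl z) (Inr y) \<le> dX x (u n) + C + dX (v n) y" for n
      by (smt (verit))
    then have "dX x z - ?c (Inl z) (Inr y) \<le> ?c (Inl x) (Inr y)" by (rule link_metric_ge)
    then show ?thesis by linarith
  qed
  have t4: "dX x z \<le> ?c (Inl y) (Inr x) + ?c (Inl y) (Inr z)" if "x \<in> X" "y \<in> X" "z \<in> X" for x y z
  proof -
    have "dX x z - (dX y (u n) + C + dX (v n) x) \<le> dX y (u m) + C + dX (v m) z" for n m
      using tri[OF that(1) vX that(3), of n] tri[OF vX vX that(3), of n m]
        tri[OF uX that(2) uX, of n m] quasi[of n m] com[of "u n" y] com[of "v n" x]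
      by linarith
    then have "dX x z - (dX y (u n) + C + dX (v n) x) \<le> ?c (Inl y) (Inr z)" for n
      by (rule link_metric_ge)
    then have "dX x z - ?c (Inl y) (Inr z) \<le> dX y (u n) + C + dX (v n) x" for n
      by (smt (verit))
    then have "dX x z - ?c (Inl y) (Inr z) \<le> ?c (Inl y) (Inr x)" by (rule link_metric_ge)
    then show ?thesis by linarith
  qed
  have lr: "?c (Inr x) (Inl y) = ?c (Inl y) (Inr x)" for x y by simp
  have ss: "?c (Inl x) (Inl y) = dX x y" "?c (Inr x) (Inr y) = dX x y" for x y by simp_all
  have M: "Metric_space (X <+> X) ?c"
  proof
    fix a b
    have "0 \<le> ?c (Inl x) (Inr y)" for x y using pos[of x y] C by linarith
    then show "0 \<le> ?c a b"
      by (cases a; cases b) (simp_all only: lr ss nonneg)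
    show "?c a b = ?c b a"
      by (cases a; cases b) (simp_all add: com)
  next
    fix a b assume ab: "a \<in> X <+> X" "b \<in> X <+> X"
    have "?c (Inl x) (Inr y) \<noteq> 0" for x y
      using pos[of x y] C by linarith
    then show "?c a b = 0 \<longleftrightarrow> a = b"
      using ab lr Metric_space.zero[OF X]
      by (cases a; cases b) (auto simp del: link_metric.simps(3,4))
  next
    fix a b c assume abc: "a \<in> X <+> X" "b \<in> X <+> X" "c \<in> X <+> X"
    obtain x y z where xyz: "a = Inl x \<or> a = Inr x" "b = Inl y \<or> b = Inr y" "c = Inl z \<or> c = Inr z"
        "x \<in> X" "y \<in> X" "z \<in> X"
      using abc by blast
    note f = t1[OF xyz(4,5,6)] t1[OF xyz(6,5,4)] t2[OF xyz(4,5,6)] t2[OF xyz(6,5,4)]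
      t3[OF xyz(4,5,6)] t4[OF xyz(4,5,6)] tri[OF xyz(4,5,6)] com[of z y] com[of y x]
    \<comment> \<open>Of the eight placements of the points, two lie in one copy; by symmetry each
      of the others is an instance of \<open>t1\<close> to \<open>t4\<close>.\<close>
    show "?c a c \<le> ?c a b + ?c b c"
      using xyz(1,2,3) by (elim disjE; simp only: ss lr; use f in linarith)
  qed
  have "ereal C \<le> (INF x\<in>X. INF y\<in>X. ereal (?c (Inl x) (Inr y)))"
    using pos by (intro INF_greatest) (simp del: link_metric.simps)
  moreover have "0 < ereal C" using C by simp
  ultimately have "0 < (INF x\<in>X. INF y\<in>X. ereal (?c (Inl x) (Inr y)))" by order
  then show ?thesis using M unfolding double_metrics_def by simp
qed

end

section \<open>R-spaces: commutativity up to coarse equivalence\<close>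

lemma double_metrics_triangle:
  assumes "d \<in> double_metrics X dX" "x \<in> X" "y \<in> X" "z \<in> X"
  shows "d (Inl x) (Inr z) \<le> dX x y + d (Inl y) (Inr z)"
    and "d (Inl x) (Inr z) \<le> d (Inl x) (Inr y) + dX y z"
    and "dX x z \<le> d (Inl x) (Inr y) + d (Inl z) (Inr y)"
    and "dX x z \<le> d (Inl y) (Inr x) + d (Inl y) (Inr z)"
proof -
  have M: "Metric_space (X <+> X) d"
    and r: "d (Inl x) (Inl y) = dX x y" "d (Inr y) (Inr z) = dX y z"
      "d (Inl x) (Inl z) = dX x z" "d (Inr x) (Inr z) = dX x z"
    using assms by (auto simp: double_metrics_def)
  have com: "d a b = d b a" for a b by (rule Metric_space.commute[OF M])
  have tri: "d a c \<le> d a b + d b c" if "a \<in> X <+> X" "b \<in> X <+> X" "c \<in> X <+> X" for a b c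
    using Metric_space.triangle[OF M] that by blast
  note [simp] = assms(2-4) InlI InrI
  show "d (Inl x) (Inr z) \<le> dX x y + d (Inl y) (Inr z)"
    using tri[of "Inl x" "Inl y" "Inr z"] r by simp
  show "d (Inl x) (Inr z) \<le> d (Inl x) (Inr y) + dX y z"
    using tri[of "Inl x" "Inr y" "Inr z"] r by simp
  show "dX x z \<le> d (Inl x) (Inr y) + d (Inl z) (Inr y)"
    using tri[of "Inl x" "Inr y" "Inl z"] r com[of "Inr y" "Inl z"] by simp
  show "dX x z \<le> d (Inl y) (Inr x) + d (Inl y) (Inr z)"
    using tri[of "Inr x" "Inl y" "Inr z"] r com[of "Inr x" "Inl y"] by simp
qed

text \<open>Pairs linked within \<open>r\<close> but ever farther apart in \<open>X\<close> would
  form two sequences with the same mutual distances up to a constant, contrary to the R-space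
  property.\<close>

lemma R_space_linked_bounded:
  assumes X: "Metric_space X dX" and R: "R_space X dX" and d: "d \<in> double_metrics X dX"
  obtains D where "D \<ge> 0"
    "\<And>x y. x \<in> X \<Longrightarrow> y \<in> X \<Longrightarrow> d (Inl x) (Inr y) \<le> r \<Longrightarrow> dX x y \<le> D"
proof -
  have "\<exists>D\<ge>0. \<forall>x\<in>X. \<forall>y\<in>X. d (Inl x) (Inr y) \<le> r \<longrightarrow> dX x y \<le> D"
  proof (rule ccontr)
    assume "\<not> ?thesis"
    then have "\<exists>x y. x \<in> X \<and> y \<in> X \<and> d (Inl x) (Inr y) \<le> r \<and> dX x y > real n" for n
      by (meson not_le of_nat_0_le_iff)
    then obtain x y where xy: "x n \<in> X" "y n \<in> X" "d (Inl (x n)) (Inr (y n)) \<le> r"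
        "dX (x n) (y n) > real n" for n
      by metis
    \<comment> \<open>Replacing both ends of a distance through their links changes it by at most
      \<open>2 * r\<close>; the added 1 gives strictness and a positive constant.\<close>
    have "\<bar>dX (x n) (x m) - dX (y n) (y m)\<bar> < 2 * \<bar>r\<bar> + 1" for n m
      using double_metrics_triangle(1)[OF d xy(1)[of n] xy(1)[of m] xy(2)[of m]]
        double_metrics_triangle(4)[OF d xy(2)[of n] xy(1)[of n] xy(2)[of m]]
        double_metrics_triangle(2)[OF d xy(1)[of n] xy(2)[of n] xy(2)[of m]]
        double_metrics_triangle(3)[OF d xy(1)[of n] xy(2)[of m] xy(1)[of m]]
        xy(3)[of n] xy(3)[of m] by linarith
    moreover have "0 < 2 * \<bar>r\<bar> + 1" "range x \<subseteq> X" "range y \<subseteq> X" using xy(1,2) by auto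
    ultimately have "\<exists>D>0. \<forall>n. dX (x n) (y n) < D"
      using R unfolding R_space_def by blast
    then obtain D where D: "dX (x n) (y n) < D" for n by blast
    obtain n where "D < real n" using reals_Archimedean2 by blast
    then show False using D[of n] xy(4)[of n] by linarith
  qed
  then show ?thesis using that by blast
qed

text \<open>If \<open>d\<close> links \<open>x\<close> to \<open>y\<close> and \<open>\<rho>\<close>
  links \<open>y\<close> to \<open>z\<close> at bounded cost, the three points are close in
  \<open>X\<close>, so the opposite composition can use \<open>x\<close> itself as intermediate
  point.\<close>

lemma R_space_comp_bounded:
  assumes ne: "X \<noteq> {}" and X: "Metric_space X dX" and R: "R_space X dX"
    and m: "\<rho> \<in> double_metrics X dX" "d \<in> double_metrics X dX"
  shows "\<forall>r. \<exists>S. \<forall>z1\<in>X <+> X. \<forall>z2\<in>X <+> X.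
    double_comp X dX \<rho> d z1 z2 \<le> r \<longrightarrow> double_comp X dX d \<rho> z1 z2 \<le> S"
proof
  fix r
  let ?c = "double_comp X dX \<rho> d" and ?c' = "double_comp X dX d \<rho>"
  obtain D where D: "\<And>x y. x \<in> X \<Longrightarrow> y \<in> X \<Longrightarrow> d (Inl x) (Inr y) \<le> r + 1 \<Longrightarrow> dX x y \<le> D"
    using R_space_linked_bounded[OF X R m(2)] by metis
  obtain E where E: "\<And>x y. x \<in> X \<Longrightarrow> y \<in> X \<Longrightarrow> \<rho> (Inl x) (Inr y) \<le> r + 1 \<Longrightarrow> dX x y \<le> E"
    using R_space_linked_bounded[OF X R m(1)] by metis
  \<comment> \<open>The estimates below give \<open>2 * D + E + (r + 1)\<close> for the leg from
    \<open>x\<close> to its own copy under \<open>\<rho>\<close>, and \<open>E + (r + 1)\<close> for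
    the leg under \<open>d\<close>.\<close>
  let ?S = "2 * D + 2 * E + 2 * (r + 1)"
  have lr: "?c' (Inl x) (Inr z) \<le> ?S" if x: "x \<in> X" and z: "z \<in> X"
    and le: "?c (Inl x) (Inr z) \<le> r" for x z
  proof -
    \<comment> \<open>The infimum in the composition need not be attained, hence the slack of
      1.\<close>
    have "\<exists>y\<in>X. d (Inl x) (Inr y) + \<rho> (Inl y) (Inr z) < r + 1"
    proof (rule ccontr)
      assume "\<not> ?thesis"
      then have "r + 1 \<le> ?c (Inl x) (Inr z)"
        by (intro comp_ge[OF ne X m]) (simp add: not_less)
      then show False using le by linarith
    qed
    then obtain y where y: "y \<in> X" "d (Inl x) (Inr y) + \<rho> (Inl y) (Inr z) < r + 1" by blast
    have "0 \<le> d (Inl x) (Inr y)" "0 \<le> \<rho> (Inl y) (Inr z)"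
      using m double_metrics_nonneg by blast+
    then have le1: "d (Inl x) (Inr y) \<le> r + 1" "\<rho> (Inl y) (Inr z) \<le> r + 1"
      using y(2) by linarith+
    have "?c' (Inl x) (Inr z) \<le> \<rho> (Inl x) (Inr x) + d (Inl x) (Inr z)"
      by (rule comp_le[OF ne X m(2,1) x])
    moreover have "\<rho> (Inl x) (Inr x) \<le> \<rho> (Inl x) (Inr z) + dX z x"
      by (rule double_metrics_triangle(2)[OF m(1) x z x])
    moreover have "\<rho> (Inl x) (Inr z) \<le> dX x y + \<rho> (Inl y) (Inr z)"
      by (rule double_metrics_triangle(1)[OF m(1) x y(1) z])
    moreover have "d (Inl x) (Inr z) \<le> d (Inl x) (Inr y) + dX y z"
      by (rule double_metrics_triangle(2)[OF m(2) x y(1) z])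
    moreover have "dX z x \<le> dX x y + dX y z"
      using Metric_space.triangle[OF X x y(1) z] Metric_space.commute[OF X, of x z] by linarith
    ultimately show ?thesis using D[OF x y(1) le1(1)] E[OF y(1) z le1(2)] le1
      by (smt (verit))
  qed
  \<comment> \<open>On a single copy both compositions equal \<open>dX\<close>, so there
    \<open>r\<close> itself is a bound.\<close>
  have "?c' z1 z2 \<le> max r ?S" if z: "z1 \<in> X <+> X" "z2 \<in> X <+> X" "?c z1 z2 \<le> r" for z1 z2
  proof (cases z1; cases z2)
    fix x y assume "z1 = Inl x" "z2 = Inr y"
    then show ?thesis using lr[of x y] z by (auto simp del: double_comp.simps(3,4))
  next
    fix x y assume e: "z1 = Inr y" "z2 = Inl x"
    have "?c (Inr y) (Inl x) = ?c (Inl x) (Inr y)" "?c' (Inr y) (Inl x) = ?c' (Inl x) (Inr y)"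
      by simp_all
    then show ?thesis using e lr[of x y] z by (auto simp del: double_comp.simps(3,4))
  qed (use z in auto)
  then show "\<exists>S. \<forall>z1\<in>X <+> X. \<forall>z2\<in>X <+> X. ?c z1 z2 \<le> r \<longrightarrow> ?c' z1 z2 \<le> S" by blast
qed

section \<open>Spaces that are not R-spaces: elements that do not commute\<close>

text \<open>A subsequence is chosen along which the distance to a base point grows so fast that
  terms with different indices are separated by their radii; terms with the same index are chosen
  far apart directly.\<close>

lemma not_R_space_sequences:
  fixes X :: "'a set"
  assumes X: "Metric_space X dX" and R: "\<not> R_space X dX"
  obtains C u v where "C > 0" "range u \<subseteq> X" "range v \<subseteq> X"
    "\<And>n m. \<bar>dX (u n) (u m) - dX (v n) (v m)\<bar> < C"
    "\<And>n m. real n \<le> dX (u m) (v n)"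
proof -
  \<comment> \<open>\<open>W\<close> is worded so that its satisfiability is literally the unfolded
    negation of \<open>R_space\<close>.\<close>
  define W where "W C x y \<longleftrightarrow> (range x \<subseteq> X \<and> range y \<subseteq> X \<and>
      (\<forall>n m. \<bar>dX (x n) (x m) - dX (y n) (y m)\<bar> < C)) \<and>
      \<not> (\<exists>D>0. \<forall>n. dX (x n) (y n) < D)" for C and x y :: "nat \<Rightarrow> 'a"
  have "\<exists>C>0. \<exists>x y. W C x y"
    using R unfolding R_space_def not_all not_imp W_def .
  then obtain C x y where C: "C > 0" and W: "W C x y" by blast
  then have rng: "range x \<subseteq> X" "range y \<subseteq> X"
    and quasi: "\<bar>dX (x n) (x m) - dX (y n) (y m)\<bar> < C"
    and unb: "\<not> (\<exists>D>0. \<forall>n. dX (x n) (y n) < D)" for n m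
    unfolding W_def by simp_all
  have xX: "x n \<in> X" and yX: "y n \<in> X" for n using rng by auto
  have com: "dX a b = dX b a" for a b by (rule Metric_space.commute[OF X])
  have tri: "dX a c \<le> dX a b + dX b c" if "a \<in> X" "b \<in> X" "c \<in> X" for a b c
    using Metric_space.triangle[OF X] that by blast
  have "\<exists>n. B \<le> dX (x n) (y n)" for B
  proof (rule ccontr)
    assume "\<not> ?thesis"
    then have "dX (x n) (y n) < max B 1" for n by (simp add: not_le less_max_iff_disj)
    then show False using unb by (metis less_max_iff_disj zero_less_one)
  qed
  then obtain g where g: "B \<le> dX (x (g B)) (y (g B))" for B by metis
  \<comment> \<open>The radius \<open>p n\<close> of \<open>x n\<close> about \<open>x 0\<close> is
    also that of \<open>y n\<close>, up to the error \<open>K\<close>.\<close>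
  define p where "p n = dX (x n) (x 0)" for n
  define K where "K = C + dX (x 0) (y 0)"
  have p0: "0 \<le> p n" for n unfolding p_def by (rule Metric_space.nonneg[OF X])
  have K0: "0 \<le> K" unfolding K_def using C Metric_space.nonneg[OF X, of "x 0" "y 0"] by simp
  have q: "\<bar>p n - dX (y n) (x 0)\<bar> \<le> K" for n
    unfolding p_def K_def
    using quasi[of n 0] tri[OF yX[of n] xX[of 0] yX[of 0]] tri[OF yX[of n] yX[of 0] xX[of 0]]
      com[of "x 0" "y 0"] by linarith
  \<comment> \<open>A large gap between \<open>x n\<close> and \<open>y n\<close> thus forces a
    large radius, so that \<open>g\<close> controls \<open>p\<close> as well.\<close>
  have dp: "dX (x n) (y n) \<le> 2 * p n + K" for n
    using q[of n] tri[OF xX[of n] xX[of 0] yX[of n]] com[of "x 0" "y n"]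
    unfolding p_def by linarith
  have far: "p m - p n - K \<le> dX (x m) (y n)" "p n - p m - K \<le> dX (x m) (y n)" for m n
    using q[of n] tri[OF xX[of m] yX[of n] xX[of 0]] tri[OF yX[of n] xX[of m] xX[of 0]]
      com[of "y n" "x m"] unfolding p_def by linarith+
  \<comment> \<open>The argument of \<open>g\<close> inverts the bound \<open>dp\<close>: the radius
    grows by at least \<open>real k + 1 + K\<close>, of which \<open>K\<close> makes up for the loss
    in \<open>far\<close> and \<open>real k + 1\<close> remains. The same choice puts the two terms
    at index \<open>r (Suc k)\<close> at least \<open>k + 1\<close> apart.\<close>
  define r where "r = rec_nat (g 0) (\<lambda>k i. g (2 * (p i + real k + 1 + K) + K))"
  have r0: "r 0 = g 0" and rS: "r (Suc k) = g (2 * (p (r k) + real k + 1 + K) + K)" for k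
    by (simp_all add: r_def)
  have step_d: "2 * (p (r k) + real k + 1 + K) + K \<le> dX (x (r (Suc k))) (y (r (Suc k)))" for k
    unfolding rS by (rule g)
  have step: "p (r k) + real k + 1 + K \<le> p (r (Suc k))" for k
    using step_d[of k] dp[of "r (Suc k)"] by (simp add: algebra_simps)
  have mono: "p (r i) \<le> p (r j)" if "i \<le> j" for i j
  proof (rule lift_Suc_mono_le[of "\<lambda>i. p (r i)", OF _ that])
    show "p (r k) \<le> p (r (Suc k))" for k using step[of k] K0 of_nat_0_le_iff[of k] by linarith
  qed
  \<comment> \<open>Off the diagonal a single step between the indices suffices: the one into
    \<open>n\<close> if \<open>m < n\<close>, the one out of \<open>n\<close> if
    \<open>n < m\<close>.\<close>
  have "real n \<le> dX (x (r m)) (y (r n))" for n m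
  proof (cases m n rule: linorder_cases)
    case equal
    then show ?thesis
    proof (cases n)
      case 0 then show ?thesis using Metric_space.nonneg[OF X] by simp
    next
      case (Suc k) then show ?thesis using equal step_d[of k] p0[of "r k"] K0 by auto
    qed
  next
    case less
    then obtain k where k: "n = Suc k" "m \<le> k" by (metis less_Suc_eq_le not0_implies_Suc not_less0)
    then show ?thesis using step[of k] mono[OF k(2)] far(2)[of "r n" "r m"] by simp
  next
    case greater
    then show ?thesis using step[of n] mono[of "Suc n" m] far(1)[of "r m" "r n"] by simp
  qed
  then have "real n \<le> dX ((x \<circ> r) m) ((y \<circ> r) n)" for n m by simp
  moreover have "\<bar>dX ((x \<circ> r) n) ((x \<circ> r) m) - dX ((y \<circ> r) n) ((y \<circ> r) m)\<bar> < C" for n m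
    using quasi by simp
  moreover have "range (x \<circ> r) \<subseteq> X" "range (y \<circ> r) \<subseteq> X" using xX yX by auto
  ultimately show ?thesis using that C by presburger
qed

text \<open>With the partial identity first, \<open>u n\<close> goes to itself and then to
  \<open>v n\<close> at cost at most \<open>2 * C\<close>. In the other order the last leg leaves a
  bridge at some \<open>u m\<close>, at distance at least \<open>n\<close> from \<open>v n\<close>,
  so the cost is unbounded.\<close>

lemma not_R_space_not_commuting:
  assumes X: "Metric_space X dX" and R: "\<not> R_space X dX"
  obtains \<rho> d where "\<rho> \<in> double_metrics X dX" "d \<in> double_metrics X dX"
    "(double_comp X dX \<rho> d, double_comp X dX d \<rho>) \<notin> coarse_rel X dX"
proof -
  obtain C u v where C: "C > 0" and rng: "range u \<subseteq> X" "range v \<subseteq> X"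
    and quasi: "\<And>n m. \<bar>dX (u n) (u m) - dX (v n) (v m)\<bar> < C"
    and far: "\<And>n m. real n \<le> dX (u m) (v n)"
    using not_R_space_sequences[OF X R] by metis
  have uX: "u n \<in> X" and vX: "v n \<in> X" for n using rng by auto
  then have ne: "X \<noteq> {}" by blast
  have zero: "dX a a = 0" if "a \<in> X" for a using Metric_space.zero[OF X] that by blast
  \<comment> \<open>\<open>?d\<close> is the partial isometry from \<open>u\<close> to
    \<open>v\<close>, and \<open>?\<rho>\<close> the partial identity on the range of
    \<open>u\<close>.\<close>
  let ?d = "link_metric dX C u v" and ?\<rho> = "link_metric dX C u u"
  have quasi_d: "\<bar>dX (u n) (u m) - dX (v n) (v m)\<bar> \<le> 2 * C"
    and quasi_\<rho>: "\<bar>dX (u n) (u m) - dX (u n) (u m)\<bar> \<le> 2 * C" for n m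
    using quasi[of n m] C by linarith+
  have d: "?d \<in> double_metrics X dX" and \<rho>: "?\<rho> \<in> double_metrics X dX"
    using link_metric_in_double_metrics[OF X C rng quasi_d]
      link_metric_in_double_metrics[OF X C rng(1) rng(1) quasi_\<rho>] by blast+
  have near: "double_comp X dX ?d ?\<rho> (Inl (u n)) (Inr (v n)) \<le> 2 * C" for n
    using comp_le[OF ne X d \<rho> uX[of n], of "u n" "v n"]
      link_metric_le[OF X C rng quasi_d, of "u n" "v n" n]
      link_metric_le[OF X C rng(1) rng(1) quasi_\<rho>, of "u n" "u n" n]
      zero[OF uX[of n]] zero[OF vX[of n]] by linarith
  have away: "real n \<le> double_comp X dX ?\<rho> ?d (Inl (u n)) (Inr (v n))" for n
  proof (rule comp_ge[OF ne X \<rho> d])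
    fix z
    \<comment> \<open>Whatever the intermediate point \<open>z\<close>, the second leg alone is
      long.\<close>
    have "real n \<le> ?\<rho> (Inl z) (Inr (v n))"
    proof (rule link_metric_ge[OF X C rng(1) rng(1) quasi_\<rho>])
      fix m show "real n \<le> dX z (u m) + C + dX (u m) (v n)"
        using far[of n m] C Metric_space.nonneg[OF X, of z "u m"] by linarith
    qed
    then show "real n \<le> ?d (Inl (u n)) (Inr z) + ?\<rho> (Inl z) (Inr (v n))"
      using double_metrics_nonneg[OF d, of "Inl (u n)" "Inr z"] by linarith
  qed
  have "(double_comp X dX ?\<rho> ?d, double_comp X dX ?d ?\<rho>) \<notin> coarse_rel X dX"
  proof
    assume "(double_comp X dX ?\<rho> ?d, double_comp X dX ?d ?\<rho>) \<in> coarse_rel X dX"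
    then have "coarse_equiv (X <+> X) (double_comp X dX ?\<rho> ?d) (double_comp X dX ?d ?\<rho>)"
      by (simp add: coarse_rel_def)
    then obtain S where "\<forall>z1\<in>X <+> X. \<forall>z2\<in>X <+> X.
        double_comp X dX ?d ?\<rho> z1 z2 \<le> 2 * C \<longrightarrow> double_comp X dX ?\<rho> ?d z1 z2 \<le> S"
      unfolding coarse_equiv_iff'[OF comp_in_double_metrics[OF ne X \<rho> d]
        comp_in_double_metrics[OF ne X d \<rho>]] by blast
    then have S: "double_comp X dX ?\<rho> ?d (Inl (u n)) (Inr (v n)) \<le> S" for n
      using near[of n] uX[of n] vX[of n] by blast
    obtain n where "S < real n" using reals_Archimedean2 by blast
    then show False using S[of n] away[of n] by linarith
  qed
  then show ?thesis using that \<rho> d by blast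
qed

theorem theorem7p2:
  fixes X :: "'a set" and dX :: "'a \<Rightarrow> 'a \<Rightarrow> real"
  assumes "Metric_space X dX"
  shows "R_space X dX \<longleftrightarrow>
    (\<forall>a\<in>M_carrier X dX. \<forall>b\<in>M_carrier X dX. M_mult X dX a b = M_mult X dX b a)"
proof
  assume R: "R_space X dX"
  show "\<forall>a\<in>M_carrier X dX. \<forall>b\<in>M_carrier X dX. M_mult X dX a b = M_mult X dX b a"
  proof (intro ballI)
    fix a b assume "a \<in> M_carrier X dX" "b \<in> M_carrier X dX"
    then obtain \<rho> d where \<rho>: "\<rho> \<in> double_metrics X dX" "a = coarse_rel X dX `` {\<rho>}"
      and d: "d \<in> double_metrics X dX" "b = coarse_rel X dX `` {d}"
      unfolding M_carrier_def by (metis quotientE)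
    show "M_mult X dX a b = M_mult X dX b a"
    proof (cases "X = {}")
      \<comment> \<open>The lemmas on compositions take infima over \<open>X\<close> and need a
        point of it. Over the empty space all elements of \<open>double_metrics\<close> are coarsely
        equivalent, so \<open>a = b\<close>.\<close>
      case True
      then have "(\<rho>, d) \<in> coarse_rel X dX"
        using coarse_equiv_iff'[OF \<rho>(1) d(1)] \<rho>(1) d(1) by (simp add: coarse_rel_def Plus_def)
      then have "a = b"
        using \<rho>(2) d(2) equiv_class_eq[OF equiv_coarse_rel] by blast
      then show ?thesis by simp
    next
      case False
      note comp = comp_in_double_metrics[OF False assms \<rho>(1) d(1)]
        comp_in_double_metrics[OF False assms d(1) \<rho>(1)]
      \<comment> \<open>The bound applied with \<open>\<rho>\<close> and \<open>d\<close> in both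
        orders yields the two halves of \<open>coarse_equiv_iff'\<close>.\<close>
      have "(double_comp X dX \<rho> d, double_comp X dX d \<rho>) \<in> coarse_rel X dX"
        using comp coarse_equiv_iff'[OF comp]
          R_space_comp_bounded[OF False assms R \<rho>(1) d(1)]
          R_space_comp_bounded[OF False assms R d(1) \<rho>(1)]
        by (simp add: coarse_rel_def)
      then show ?thesis
        unfolding \<rho>(2) d(2) M_mult_class[OF False assms \<rho>(1) d(1)]
          M_mult_class[OF False assms d(1) \<rho>(1)]
        by (rule equiv_class_eq[OF equiv_coarse_rel])
    qed
  qed
next
  assume comm: "\<forall>a\<in>M_carrier X dX. \<forall>b\<in>M_carrier X dX. M_mult X dX a b = M_mult X dX b a"
  show "R_space X dX"
  proof (rule ccontr)
    assume R: "\<not> R_space X dX"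
    then have ne: "X \<noteq> {}" by (auto simp: R_space_def)
    obtain \<rho> d where \<rho>: "\<rho> \<in> double_metrics X dX" and d: "d \<in> double_metrics X dX"
      and nc: "(double_comp X dX \<rho> d, double_comp X dX d \<rho>) \<notin> coarse_rel X dX"
      using not_R_space_not_commuting[OF assms R] by metis
    have "coarse_rel X dX `` {double_comp X dX \<rho> d} = coarse_rel X dX `` {double_comp X dX d \<rho>}"
      using comm \<rho> d quotientI unfolding M_carrier_def
      by (metis M_mult_class[OF ne assms])
    then show False
      using nc eq_equiv_class[OF _ equiv_coarse_rel] comp_in_double_metrics[OF ne assms d \<rho>]
      by blast
  qed
qed

end
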